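(* Let $(Y,\mathbb Z,\sigma)$ be a dynamical system, $f\in C(Y\times\mathbb R^n,\mathbb R^n)$, and let $\varphi(t,u,y)$ ($t\in\mathbb Z_+$) denote the unique solution of the difference equation $$u(t+1)=f(\sigma(t,y),u(t))\qquad (t\in\mathbb Z_+,\ y\in Y)$$ with $\varphi(0,u,y)=u$. Suppose that: 1. the dynamical system $(Y,\mathbb Z,\sigma)$ is pseudo recurrent; 2. the equation is uniformly contracting, i.e. there exists a number $\alpha\in(0,1)$ such that $|f(y,u_1)-f(y,u_2)|\le\alpha|u_1-u_2|$ for all $u_1,u_2\in\mathbb R^n$ and $y\in Y$. Then: 1. there exists a unique mapping $\gamma\in C(Y,\mathbb R^n)$ such that $\gamma(\sigma(t,y))=\varphi(t,\gamma(y),y)$ for all $y\in Y$ and $t\in\mathbb Z_+$; 2. the equality $$\lim_{t\to+\infty}|\varphi(t,u,y)-\varphi(t,\gamma(y),y)|=0$$ holds for all $y\in Y$ and $u\in\mathbb R^n$.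
   Context: A dynamical system $(Y,\mathbb Z,\sigma)$ on a metric space $Y$ is a continuous map $\sigma:\mathbb Z\times Y\to Y$ with $\sigma(0,y)=y$, $\sigma(s,\sigma(t,y))=\sigma(s+t,y)$. It is pseudo recurrent if $Y$ is compact, there is $y_*\in Y$ with $Y=\overline{\{\sigma(t,y_* ):t\in\mathbb Z\}}$, and every $y\in Y$ is Poisson stable (there is a sequence $\{t_n\}\subset\mathbb Z$ with $|t_n|\to\infty$ and $\sigma(t_n,y)\to y$). $|\cdot|$ is the norm on $\mathbb R^n$. *)

theory Defs
  imports "HOL-Analysis.Analysis"
begin

text \<open>The metric space is the whole type, and \<open>int\<close> carries its standard (discrete) topology, so
  continuity of \<open>\<sigma>\<close> is joint continuity on the product.\<close>

definition dynamical_system :: "(int \<times> 'y::metric_space \<Rightarrow> 'y) \<Rightarrow> bool" where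
  "dynamical_system \<sigma> \<longleftrightarrow>
     continuous_on UNIV \<sigma> \<and>
     (\<forall>y. \<sigma> (0, y) = y) \<and>
     (\<forall>s t y. \<sigma> (s, \<sigma> (t, y)) = \<sigma> (s + t, y))"

definition poisson_stable :: "(int \<times> 'y::metric_space \<Rightarrow> 'y) \<Rightarrow> 'y \<Rightarrow> bool" where
  "poisson_stable \<sigma> y \<longleftrightarrow>
     (\<exists>t :: nat \<Rightarrow> int. filterlim (\<lambda>n. \<bar>t n\<bar>) at_top sequentially \<and>
        (\<lambda>n. \<sigma> (t n, y)) \<longlonglongrightarrow> y)"

definition pseudo_recurrent :: "(int \<times> 'y::metric_space \<Rightarrow> 'y) \<Rightarrow> bool" where
  "pseudo_recurrent \<sigma> \<longleftrightarrow>
     compact (UNIV :: 'y set) \<and>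
     (\<exists>y\<^sub>0. (UNIV :: 'y set) = closure {\<sigma> (t, y\<^sub>0) | t. t \<in> UNIV}) \<and>
     (\<forall>y. poisson_stable \<sigma> y)"

text \<open>The solution of \<open>u (t + 1) = f (\<sigma> (t, y), u t)\<close> with initial value \<open>u\<close>; the two equations below
  are the initial condition and the difference equation, which determine it uniquely.\<close>

primrec solution :: "(int \<times> 'y \<Rightarrow> 'y) \<Rightarrow> ('y \<times> 'a \<Rightarrow> 'a) \<Rightarrow> nat \<Rightarrow> 'a \<Rightarrow> 'y \<Rightarrow> 'a" where
  "solution \<sigma> f 0 u y = u"
| "solution \<sigma> f (Suc t) u y = f (\<sigma> (int t, y), solution \<sigma> f t u y)"

definition uniformly_contracting :: "('y \<times> 'a::real_normed_vector \<Rightarrow> 'a) \<Rightarrow> bool" where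
  "uniformly_contracting f \<longleftrightarrow>
     (\<exists>\<alpha>::real. 0 < \<alpha> \<and> \<alpha> < 1 \<and>
        (\<forall>y u\<^sub>1 u\<^sub>2. norm (f (y, u\<^sub>1) - f (y, u\<^sub>2)) \<le> \<alpha> * norm (u\<^sub>1 - u\<^sub>2)))"

end

theory Submission
  imports Defs
begin

text \<open>
  An invariant section \<open>\<gamma>\<close>, that is, a map whose values along every orbit of \<open>\<sigma>\<close> solve the difference
  equation, is already determined by its one-step condition \<open>\<gamma> (\<sigma> (1, y)) = f (y, \<gamma> y)\<close>. Since
  \<open>\<sigma> (1, \<cdot>)\<close> is invertible, this can be solved for the left-hand side: \<open>\<gamma>\<close> is invariant iff it is a
  fixed point of the graph transform sending \<open>\<gamma>\<close> to \<open>\<lambda>y. f (\<sigma> (-1, y), \<gamma> (\<sigma> (-1, y)))\<close>, which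
  is the content of \<open>invariant_iff_graph_transform_fixed\<close>. The transform maps continuous functions
  to continuous functions and inherits the contraction constant \<open>\<alpha>\<close> of \<open>f\<close> in the sup norm. As \<open>Y\<close> is compact, every continuous function on it is bounded, so the space of \<^emph>\<open>all\<close>
  continuous functions is complete in that norm, and Banach's theorem gives existence and
  uniqueness at once (\<open>ex1_continuous_invariant_section\<close>).

  Convergence is independent of this construction: one step of the equation brings any two solutions
  over the same orbit closer by the factor \<open>\<alpha>\<close>, so after \<open>t\<close> steps their distance is at most
  \<open>\<alpha> ^ t\<close> times the initial one (\<open>norm_solution_diff_le\<close>).
\<close>

lemma norm_solution_diff_le:
  fixes f :: "'y \<times> 'a::real_normed_vector \<Rightarrow> 'a"
  assumes "0 \<le> \<alpha>" and "\<And>y u v. norm (f (y, u) - f (y, v)) \<le> \<alpha> * norm (u - v)"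
  shows "norm (solution \<sigma> f t u y - solution \<sigma> f t v y) \<le> \<alpha> ^ t * norm (u - v)"
proof (induction t)
  case 0
  show ?case by simp
next
  case (Suc t)
  have "norm (solution \<sigma> f (Suc t) u y - solution \<sigma> f (Suc t) v y)
      \<le> \<alpha> * norm (solution \<sigma> f t u y - solution \<sigma> f t v y)"
    using assms(2) by simp
  also have "\<dots> \<le> \<alpha> * (\<alpha> ^ t * norm (u - v))"
    by (rule mult_left_mono[OF Suc assms(1)])
  finally show ?case by (simp add: mult.assoc)
qed

lemma solution_diff_tendsto_zero:
  fixes f :: "'y \<times> 'a::real_normed_vector \<Rightarrow> 'a"
  assumes "uniformly_contracting f"
  shows "(\<lambda>t. norm (solution \<sigma> f t u y - solution \<sigma> f t v y)) \<longlonglongrightarrow> 0"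
proof -
  obtain \<alpha> :: real where \<alpha>: "0 < \<alpha>" "\<alpha> < 1"
    and contr: "\<And>y u v. norm (f (y, u) - f (y, v)) \<le> \<alpha> * norm (u - v)"
    using assms unfolding uniformly_contracting_def by blast
  have bound: "norm (solution \<sigma> f t u y - solution \<sigma> f t v y) \<le> \<alpha> ^ t * norm (u - v)" for t
    using norm_solution_diff_le[of \<alpha> f] \<alpha>(1) contr by simp
  have "(\<lambda>t. \<alpha> ^ t) \<longlonglongrightarrow> 0"
    using \<alpha> by (intro LIMSEQ_realpow_zero) auto
  then have "(\<lambda>t. \<alpha> ^ t * norm (u - v)) \<longlonglongrightarrow> 0"
    by (rule tendsto_mult_left_zero)
  then show ?thesis
    by (rule Lim_null_comparison[rotated]) (simp add: bound)
qed

definition graph_transform ::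
    "(int \<times> 'y \<Rightarrow> 'y) \<Rightarrow> ('y \<times> 'a \<Rightarrow> 'a) \<Rightarrow> ('y \<Rightarrow> 'a) \<Rightarrow> 'y \<Rightarrow> 'a" where
  "graph_transform \<sigma> f \<gamma> y = f (\<sigma> (-1, y), \<gamma> (\<sigma> (-1, y)))"

text \<open>The step from \<open>y\<close> to \<open>\<sigma> (1, y)\<close> generates the whole forward orbit, so invariance for all times
  reduces to time one; the group structure of time then allows the step to be read backwards.\<close>

lemma invariant_iff_graph_transform_fixed:
  assumes "dynamical_system \<sigma>"
  shows "(\<forall>y t. \<gamma> (\<sigma> (int t, y)) = solution \<sigma> f t (\<gamma> y) y) \<longleftrightarrow> graph_transform \<sigma> f \<gamma> = \<gamma>"
proof -
  have zero: "\<sigma> (0, y) = y" and add: "\<sigma> (s, \<sigma> (t, y)) = \<sigma> (s + t, y)" for s t y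
    using assms unfolding dynamical_system_def by blast+
  show ?thesis
  proof
    assume inv: "\<forall>y t. \<gamma> (\<sigma> (int t, y)) = solution \<sigma> f t (\<gamma> y) y"
    show "graph_transform \<sigma> f \<gamma> = \<gamma>"
    proof
      fix y
      have "\<gamma> (\<sigma> (int 1, \<sigma> (-1, y))) = f (\<sigma> (-1, y), \<gamma> (\<sigma> (-1, y)))"
        unfolding inv[rule_format] by (simp add: zero)
      then show "graph_transform \<sigma> f \<gamma> y = \<gamma> y"
        by (simp add: graph_transform_def add zero)
    qed
  next
    assume "graph_transform \<sigma> f \<gamma> = \<gamma>"
    then have fixed: "\<gamma> y = f (\<sigma> (-1, y), \<gamma> (\<sigma> (-1, y)))" for y
      unfolding graph_transform_def by metis
    have "\<gamma> (\<sigma> (int t, y)) = solution \<sigma> f t (\<gamma> y) y" for y t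
    proof (induction t)
      case 0
      show ?case by (simp add: zero)
    next
      case (Suc t)
      have "\<gamma> (\<sigma> (int (Suc t), y)) = f (\<sigma> (int t, y), \<gamma> (\<sigma> (int t, y)))"
        using fixed[of "\<sigma> (int (Suc t), y)"] by (simp add: add)
      then show ?case by (simp add: Suc)
    qed
    then show "\<forall>y t. \<gamma> (\<sigma> (int t, y)) = solution \<sigma> f t (\<gamma> y) y" by blast
  qed
qed

lemma continuous_on_graph_transform:
  fixes \<sigma> :: "int \<times> 'y::metric_space \<Rightarrow> 'y"
    and f :: "'y \<times> 'a::topological_space \<Rightarrow> 'a"
  assumes "dynamical_system \<sigma>" "continuous_on UNIV f" "continuous_on UNIV \<gamma>"
  shows "continuous_on UNIV (graph_transform \<sigma> f \<gamma>)"
proof -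
  have "continuous_on UNIV \<sigma>"
    using assms(1) unfolding dynamical_system_def by blast
  moreover have "continuous_on UNIV (\<lambda>y::'y. (-1::int, y))"
    by (intro continuous_intros)
  ultimately have pred: "continuous_on UNIV (\<lambda>y. \<sigma> (-1, y))"
    by (rule continuous_on_compose2) simp
  have "continuous_on UNIV (\<lambda>y. \<gamma> (\<sigma> (-1, y)))"
    by (rule continuous_on_compose2[OF assms(3) pred]) simp
  then have "continuous_on UNIV (\<lambda>y. f (\<sigma> (-1, y), \<gamma> (\<sigma> (-1, y))))"
    by (intro continuous_on_compose2[OF assms(2) continuous_on_Pair[OF pred]]) simp_all
  then show ?thesis
    by (simp add: graph_transform_def[abs_def])
qed

lemma continuous_on_compact_UNIV_imp_bcontfun:
  fixes g :: "'y::topological_space \<Rightarrow> 'a::metric_space"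
  assumes "compact (UNIV :: 'y set)" "continuous_on UNIV g"
  shows "g \<in> bcontfun"
  using assms by (simp add: bcontfun_def compact_imp_bounded compact_continuous_image)

text \<open>Compactness is used to identify the continuous functions with the bounded continuous ones: this
  makes them a complete metric space, and it makes uniqueness hold among all continuous functions.\<close>

lemma ex1_continuous_invariant_section:
  fixes \<sigma> :: "int \<times> 'y::metric_space \<Rightarrow> 'y"
    and f :: "'y \<times> 'a::banach \<Rightarrow> 'a"
  assumes cpt: "compact (UNIV :: 'y set)"
    and ds: "dynamical_system \<sigma>"
    and contf: "continuous_on UNIV f"
    and "uniformly_contracting f"
  shows "\<exists>!\<gamma>. continuous_on UNIV \<gamma> \<and> (\<forall>y t. \<gamma> (\<sigma> (int t, y)) = solution \<sigma> f t (\<gamma> y) y)"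
proof -
  obtain \<alpha> :: real where \<alpha>: "0 < \<alpha>" "\<alpha> < 1"
    and contr: "\<And>y u v. norm (f (y, u) - f (y, v)) \<le> \<alpha> * norm (u - v)"
    using assms(4) unfolding uniformly_contracting_def by blast
  define T :: "('y \<Rightarrow>\<^sub>C 'a) \<Rightarrow> ('y \<Rightarrow>\<^sub>C 'a)"
    where "T g = Bcontfun (graph_transform \<sigma> f (apply_bcontfun g))" for g
  have apply_T: "apply_bcontfun (T g) = graph_transform \<sigma> f (apply_bcontfun g)" for g
    unfolding T_def
    by (intro Bcontfun_inverse continuous_on_compact_UNIV_imp_bcontfun[OF cpt]
        continuous_on_graph_transform[OF ds contf]) simp
  have "dist (T g) (T h) \<le> \<alpha> * dist g h" for g h
  proof (rule dist_bound)
    fix y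
    let ?x = "\<sigma> (-1, y)"
    have "dist (T g y) (T h y) \<le> \<alpha> * dist (g ?x) (h ?x)"
      using contr by (simp add: apply_T graph_transform_def dist_norm)
    also have "\<dots> \<le> \<alpha> * dist g h"
      using \<alpha>(1) by (intro mult_left_mono dist_bounded) simp
    finally show "dist (T g y) (T h y) \<le> \<alpha> * dist g h" .
  qed
  with \<alpha> have "\<exists>!g. T g = g"
    by (intro banach_fix_type[of \<alpha>]) auto
  then obtain g where g: "T g = g" and uniq: "\<And>h. T h = h \<Longrightarrow> h = g" by metis
  show ?thesis
    unfolding invariant_iff_graph_transform_fixed[OF ds]
  proof (intro ex1I conjI)
    show "continuous_on UNIV (apply_bcontfun g)" by simp
    show "graph_transform \<sigma> f (apply_bcontfun g) = apply_bcontfun g"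
      using g apply_T by metis
  next
    fix \<gamma> assume \<gamma>: "continuous_on UNIV \<gamma> \<and> graph_transform \<sigma> f \<gamma> = \<gamma>"
    then have "apply_bcontfun (Bcontfun \<gamma>) = \<gamma>"
      by (intro Bcontfun_inverse continuous_on_compact_UNIV_imp_bcontfun[OF cpt]) simp
    moreover from this have "T (Bcontfun \<gamma>) = Bcontfun \<gamma>"
      using \<gamma> by (simp add: T_def)
    ultimately show "\<gamma> = apply_bcontfun g" using uniq by metis
  qed
qed

theorem theorem3p15:
  fixes \<sigma> :: "int \<times> 'y::metric_space \<Rightarrow> 'y"
    and f :: "'y \<times> (real ^ 'n) \<Rightarrow> real ^ 'n"
  assumes "dynamical_system \<sigma>"
    and "continuous_on UNIV f"
    and "pseudo_recurrent \<sigma>"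
    and "uniformly_contracting f"
  shows "(\<exists>!\<gamma> :: 'y \<Rightarrow> real ^ 'n.
            continuous_on UNIV \<gamma> \<and> (\<forall>y t. \<gamma> (\<sigma> (int t, y)) = solution \<sigma> f t (\<gamma> y) y)) \<and>
         (\<forall>\<gamma> :: 'y \<Rightarrow> real ^ 'n.
            continuous_on UNIV \<gamma> \<and> (\<forall>y t. \<gamma> (\<sigma> (int t, y)) = solution \<sigma> f t (\<gamma> y) y) \<longrightarrow>
            (\<forall>y u. (\<lambda>t. norm (solution \<sigma> f t u y - solution \<sigma> f t (\<gamma> y) y)) \<longlonglongrightarrow> 0))"
proof -
  have "compact (UNIV :: 'y set)"
    using assms(3) unfolding pseudo_recurrent_def by blast
  then show ?thesis
    by (intro conjI allI impI ex1_continuous_invariant_section solution_diff_tendsto_zero assms)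
qed

end
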